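(* There is an absolute constant $c$ such that every $n$-vertex graph $G$ has an $A\times B\times C$ three-dimensional drawing with $A,B\le c\,\mathrm{tn}(G)$ and $C\le c\, n$. Moreover, for any family $\mathcal{G}$ of graphs and any family of functions $\mathcal{F}(n)$ closed under multiplication, every $n$-vertex graph in $\mathcal{G}$ has an $A\times B\times C$ drawing with $A,B\in\mathcal{F}(n)$ and $C\in O(n)$ if and only if $\mathrm{tn}(\mathcal{G})\in\mathcal{F}(n)$.
   Context: A three-dimensional drawing of a graph represents the vertices by distinct points of $\mathbb{Z}^3$ and each edge by the straight line-segment between its end-vertices, such that edges intersect only at common end-vertices and an edge meets a vertex only if it is an end-vertex of that edge; it is an $X\times Y\times Z$ drawing if contained in an axis-aligned box with side lengths $X-1,Y-1,Z-1$. Track layouts: a colouring of $G$ is a partition $\{V_i:i\in I\}$ of $V(G)$ with no edge inside a class; a track assignment is a colouring with a total order $<_i$ on each $V_i$; an X-crossing is a pair of edges $vw$, $xy$ with $v,x\in V_i$, $w,y\in V_j$, $i\ne j$, $v<_i x$, $y<_j w$; a $t$-track layout is a track assignment with $t$ tracks and no X-crossing; $\mathrm{tn}(G)$ is the minimum such $t$. For a family $\mathcal{G}$, $\mathrm{tn}(\mathcal{G})$ is the function $n\mapsto\max\{\mathrm{tn}(G):G\in\mathcal{G},|V(G)|=n\}$.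
   Formalization: The family F(n) is also assumed closed under pointwise smaller nonnegative functions and positive constant factors, as for upper-bound classes like O(1); with closure under multiplication alone the equivalence fails (F = constant powers of 2, G = triangle plus isolated vertices). *)

theory Defs
  imports
    "HOL-Analysis.Analysis"
    "HOL-Library.Landau_Symbols"
    "HOL-Library.Disjoint_Sets"
    "Graph_Theory.Pair_Digraph"
begin

text \<open>
  A finite simple undirected graph is a \<open>pair_graph\<close>: finite, loopless and with a symmetric
  set \<open>parcs\<close> of ordered pairs. The edge \<open>uv\<close> is thus represented by both \<open>(u, v)\<close> and \<open>(v, u)\<close>,
  and two arcs are the same edge iff their end-vertex sets \<open>{u, v}\<close> coincide.
\<close>

section \<open>Three-dimensional drawings\<close>

definition drawing_3d :: "'a pair_pre_digraph \<Rightarrow> ('a \<Rightarrow> real ^ 3) \<Rightarrow> bool" where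
  "drawing_3d G p \<longleftrightarrow>
     inj_on p (pverts G) \<and>
     (\<forall>v \<in> pverts G. \<forall>i. p v $ i \<in> \<int>) \<and>
     (\<forall>u v w. (u, v) \<in> parcs G \<longrightarrow> w \<in> pverts G \<longrightarrow>
        p w \<in> closed_segment (p u) (p v) \<longrightarrow> w \<in> {u, v}) \<and>
     (\<forall>u v x y. (u, v) \<in> parcs G \<longrightarrow> (x, y) \<in> parcs G \<longrightarrow> {u, v} \<noteq> {x, y} \<longrightarrow>
        closed_segment (p u) (p v) \<inter> closed_segment (p x) (p y) \<subseteq> p ` ({u, v} \<inter> {x, y}))"

definition drawing_points :: "'a pair_pre_digraph \<Rightarrow> ('a \<Rightarrow> real ^ 3) \<Rightarrow> (real ^ 3) set" where
  "drawing_points G p = p ` pverts G \<union> (\<Union>(u, v) \<in> parcs G. closed_segment (p u) (p v))"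

text \<open>
  If one of \<open>X\<close>, \<open>Y\<close>, \<open>Z\<close> is 0, the box is empty, so that it only accommodates the graph
  without vertices.
\<close>
definition has_drawing :: "'a pair_pre_digraph \<Rightarrow> nat \<Rightarrow> nat \<Rightarrow> nat \<Rightarrow> bool" where
  "has_drawing G X Y Z \<longleftrightarrow>
     (\<exists>p a. drawing_3d G p \<and>
        drawing_points G p \<subseteq> cbox a (a + vector [real X - 1, real Y - 1, real Z - 1]))"

section \<open>Track layouts\<close>

definition colouring :: "'a pair_pre_digraph \<Rightarrow> 'a set set \<Rightarrow> bool" where
  "colouring G P \<longleftrightarrow>
     partition_on (pverts G) P \<and>
     (\<forall>V \<in> P. \<forall>u v. (u, v) \<in> parcs G \<longrightarrow> \<not> (u \<in> V \<and> v \<in> V))"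

text \<open>
  The colour classes index themselves: \<open>lt V\<close> is the (strict) total order on the track \<open>V\<close>.
\<close>
definition track_assignment ::
    "'a pair_pre_digraph \<Rightarrow> 'a set set \<Rightarrow> ('a set \<Rightarrow> 'a rel) \<Rightarrow> bool" where
  "track_assignment G P lt \<longleftrightarrow>
     colouring G P \<and> (\<forall>V \<in> P. strict_linear_order_on V (lt V))"

definition X_crossing ::
    "'a pair_pre_digraph \<Rightarrow> 'a set set \<Rightarrow> ('a set \<Rightarrow> 'a rel) \<Rightarrow> bool" where
  "X_crossing G P lt \<longleftrightarrow>
     (\<exists>V \<in> P. \<exists>W \<in> P. V \<noteq> W \<and>
        (\<exists>v \<in> V. \<exists>x \<in> V. \<exists>w \<in> W. \<exists>y \<in> W.
           (v, w) \<in> parcs G \<and> (x, y) \<in> parcs G \<and> (v, x) \<in> lt V \<and> (y, w) \<in> lt W))"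

definition track_layout ::
    "'a pair_pre_digraph \<Rightarrow> nat \<Rightarrow> 'a set set \<Rightarrow> ('a set \<Rightarrow> 'a rel) \<Rightarrow> bool" where
  "track_layout G t P lt \<longleftrightarrow> track_assignment G P lt \<and> card P = t \<and> \<not> X_crossing G P lt"

definition track_number :: "'a pair_pre_digraph \<Rightarrow> nat" where
  "track_number G = (LEAST t. \<exists>P lt. track_layout G t P lt)"

text \<open>
  Track numbers of \<open>n\<close>-vertex graphs are at most \<open>n\<close>, so this is a maximum over a finite set.
  Inserting 0 makes the value 0 if the family has no \<open>n\<close>-vertex graph.
\<close>
definition family_track_number :: "'a pair_pre_digraph set \<Rightarrow> nat \<Rightarrow> nat" where
  "family_track_number \<G> n = Max (insert 0 {track_number G | G. G \<in> \<G> \<and> card (pverts G) = n})"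

section \<open>Families of functions\<close>

definition closed_under_multiplication :: "(nat \<Rightarrow> real) set \<Rightarrow> bool" where
  "closed_under_multiplication F \<longleftrightarrow> (\<forall>f \<in> F. \<forall>g \<in> F. (\<lambda>n. f n * g n) \<in> F)"

text \<open>
  A family of functions such as \<open>O(1)\<close> or \<open>O(polylog n)\<close> is used to express an upper bound up to
  constant factors. Accordingly, it is closed under passing to smaller non-negative functions and
  under multiplication by positive constants.
\<close>
definition growth_family :: "(nat \<Rightarrow> real) set \<Rightarrow> bool" where
  "growth_family F \<longleftrightarrow>
     (\<forall>f \<in> F. \<forall>g. (\<forall>n. 0 \<le> g n \<and> g n \<le> f n) \<longrightarrow> g \<in> F) \<and>
     (\<forall>f \<in> F. \<forall>k > 0. (\<lambda>n. k * f n) \<in> F)"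

lemma growth_family_bigo: "growth_family O(f)"
  unfolding growth_family_def
proof (intro conjI ballI allI impI)
  fix g h :: "nat \<Rightarrow> real"
  assume g: "g \<in> O(f)" and h: "\<forall>n. 0 \<le> h n \<and> h n \<le> g n"
  have "h \<in> O(g)"
    using h by (intro bigoI[of _ 1] always_eventually) (auto intro: order.trans)
  then show "h \<in> O(f)"
    using g by (rule landau_o.big_trans)
qed simp

lemma closed_under_multiplication_bigo_1: "closed_under_multiplication O(\<lambda>_. 1)"
  unfolding closed_under_multiplication_def
proof (intro ballI)
  fix f g :: "nat \<Rightarrow> real"
  assume "f \<in> O(\<lambda>_. 1)" and "g \<in> O(\<lambda>_. 1)"
  then have "(\<lambda>n. f n * g n) \<in> O(\<lambda>_. 1 * 1)"
    by (rule landau_o.big.mult)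
  then show "(\<lambda>n. f n * g n) \<in> O(\<lambda>_. 1)"
    by simp
qed

end

theory Submission
  imports Defs "HOL-Real_Asymp.Real_Asymp" "HOL-Computational_Algebra.Primes"
begin

text \<open>
  From a layout with \<open>t\<close> tracks to a drawing: cut the tracks into at most \<open>2t\<close> tracks with at most
  \<open>n/t + 1\<close> vertices each, take a prime \<open>p\<close> with \<open>2t \<le> p \<in> O(t)\<close>, and put the \<open>h\<close>-th vertex of track
  \<open>c\<close> at \<open>(c, c\<^sup>2 mod p, p h + (c\<^sup>3 mod p))\<close>. Modulo \<open>p\<close> these points lie on the moment curve, so by
  Vandermonde no four vertices in different tracks are coplanar and no three different tracks project
  to collinear points. Hence two edges can only cross if they join the same two tracks, and then
  they form an X-crossing.

  Conversely, the vertices on each of the at most \<open>AB\<close> vertical lines of an \<open>A \<times> B \<times> C\<close> drawing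
  form two tracks, because edges inside a line join consecutive vertices, and an X-crossing between
  tracks on different lines is a crossing in the drawing.
\<close>

section \<open>A linear bound for the next prime\<close>

lemma prime_power_dvd_lcmD:
  fixes a b :: nat
  assumes "prime p" and "a \<noteq> 0" and "b \<noteq> 0" and "p ^ e dvd lcm a b"
  shows "p ^ e dvd a \<or> p ^ e dvd b"
proof -
  have "multiplicity p (lcm a b) = max (multiplicity p a) (multiplicity p b)"
    using assms by (simp add: prime_factorization_lcm flip: count_prime_factorization_prime)
  moreover have "e \<le> multiplicity p (lcm a b)"
    using assms by (intro multiplicity_geI) (auto simp: prime_nat_iff)
  ultimately show ?thesis
    using assms by (auto simp: max_def multiplicity_dvd' split: if_splits)
qed

text \<open>Exponents in an \<open>lcm\<close> are maxima, so a prime power dividing it divides one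
  of the arguments; by induction it divides one of \<open>1, ..., n\<close>.\<close>

lemma prime_power_dvd_Lcm_imp_le:
  assumes "prime (p::nat)" and "p ^ e dvd Lcm {1..n}" and "n \<ge> 1"
  shows "p ^ e \<le> n"
  using assms(2,3)
proof (induction n)
  case (Suc n)
  have "{1..Suc n} = insert (Suc n) {1..n}"
    by auto
  then have eq: "Lcm {1..Suc n} = lcm (Suc n) (Lcm {1..n})"
    by simp
  have "Lcm {1..n} \<noteq> 0"
    by (auto simp: Lcm_0_iff)
  then have "p ^ e dvd Suc n \<or> p ^ e dvd Lcm {1..n}"
    using prime_power_dvd_lcmD[OF assms(1), of "Suc n" "Lcm {1..n}" e] Suc.prems eq by simp
  then show ?case
  proof
    assume "p ^ e dvd Suc n"
    then show ?case
      using dvd_imp_le by blast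
  next
    assume *: "p ^ e dvd Lcm {1..n}"
    show ?case
    proof (cases "n = 0")
      case False
      then show ?thesis
        using Suc.IH * by simp
    qed (use * in auto)
  qed
qed simp

text \<open>Leibniz harmonic triangle: \<open>L(n,k) = 1 / (k * (n choose k))\<close> satisfies
  \<open>L(n+1,k+1) = L(n,k) - L(n+1,k)\<close>. A number divisible by both denominators on the
  right is therefore divisible by the one on the left. The outer induction supplies row
  \<open>n\<close>, the inner one column \<open>k\<close>.\<close>

lemma mult_binomial_dvd_Lcm:
  assumes "1 \<le> k" and "k \<le> n"
  shows "k * (n choose k) dvd Lcm {1..n}"
  using assms
proof (induction n arbitrary: k)
  case (Suc n)
  let ?L = "Lcm {1..Suc n}"
  have "Lcm {1..n} dvd ?L"
    by (rule Lcm_subset) auto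
  then have IH: "k * (n choose k) dvd ?L" if "1 \<le> k" "k \<le> n" for k
    using Suc.IH[OF that] dvd_trans by blast
  show ?case
    using Suc.prems
  proof (induction k rule: dec_induct)
    case base
    show ?case
      using dvd_Lcm[of "Suc n" "{1..Suc n}"] by simp
  next
    case (step k)
    then have k: "1 \<le> k" "k \<le> n"
      by auto
    obtain a where a: "?L = k * (Suc n choose k) * a"
      using step k by (auto elim: dvdE)
    obtain b where b: "?L = k * (n choose k) * b"
      using IH k by (auto elim: dvdE)
    have e1: "(n choose k) * Suc n = (Suc n choose k) * (Suc n - k)"
      using binomial_absorb_comp[of "Suc n" k] by (simp add: mult.commute)
    have e2: "Suc k * (Suc n choose Suc k) = Suc n * (n choose k)"
      by (rule Suc_times_binomial)
    have pos: "n choose k > 0"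
      using k by simp
    have "(Suc n - k) * b = Suc n * a"
    proof -
      have "(k * (n choose k)) * (Suc n * a) = k * ((n choose k) * Suc n) * a"
        by (simp add: algebra_simps)
      also have "\<dots> = k * ((Suc n choose k) * (Suc n - k)) * a"
        by (simp only: e1)
      also have "\<dots> = (Suc n - k) * ?L"
        unfolding a by (simp only: ac_simps)
      also have "\<dots> = (k * (n choose k)) * ((Suc n - k) * b)"
        unfolding b by (simp only: ac_simps)
      finally show ?thesis
        using pos k by simp
    qed
    \<comment> \<open>The difference \<open>b - a\<close> is the quotient sought; the passage to
      \<open>int\<close> avoids truncated subtraction.\<close>
    then have "int (Suc n - k) * int b = int (Suc n) * int a"
      by (metis of_nat_mult)
    then have "int (Suc n) * (int b - int a) = int k * int b"
      using k by (simp add: of_nat_diff algebra_simps)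
    moreover have "int k * int (n choose k) * int b = int ?L"
      using b by (metis of_nat_mult)
    ultimately have "int ?L = int (Suc k * (Suc n choose Suc k)) * (int b - int a)"
      unfolding e2 of_nat_mult by (simp only: ac_simps) (metis (no_types, lifting) mult.left_commute mult.commute)
    then have "int (Suc k * (Suc n choose Suc k)) dvd int ?L"
      by (rule dvdI)
    then show ?case
      by (simp only: int_dvd_int_iff)
  qed
qed simp

section \<open>An exponential bound for the product of the primes up to \<open>n\<close>\<close>

lemma prod_primes_dvd:
  fixes c :: nat
  assumes "finite A" and "\<And>p. p \<in> A \<Longrightarrow> prime p" and "\<And>p. p \<in> A \<Longrightarrow> p dvd c"
  shows "\<Prod>A dvd c"
  using assms
proof (induction A)
  case (insert q A)
  have "coprime q (\<Prod>A)"
    using insert by (intro prod_coprime_right primes_coprime) auto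
  then show ?case
    using insert by (auto intro: divides_mult)
qed simp

text \<open>Argument of Erdos: for \<open>n = 2 * k + 1\<close> the primes from \<open>k + 2\<close>
  to \<open>n\<close> all divide \<open>n choose k\<close>, which is at most \<open>4 ^ k\<close>,
  and induction handles the primes up to \<open>k + 1\<close>. An even \<open>n > 2\<close>
  contributes no prime.\<close>

lemma prod_primes_le: "\<Prod>{p. prime p \<and> p \<le> (n::nat)} \<le> 4 ^ n"
proof (induction n rule: less_induct)
  case (less n)
  let ?P = "\<lambda>n. {p::nat. prime p \<and> p \<le> n}"
  have fin: "finite (?P n)" for n
    by (rule finite_subset[of _ "{..n}"]) auto
  consider "n = 0" | "n = 1" | "n = 2" | "even n" "n > 2" | k where "n = 2 * k + 1" "k \<ge> 1"
  proof (cases "even n")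
    case True
    then show ?thesis
      using that by (cases "n = 0 \<or> n = 2") (auto elim!: evenE)
  next
    case False
    then obtain k where "n = 2 * k + 1"
      by (rule oddE)
    then show ?thesis
      using that by (cases "k = 0") auto
  qed
  then show ?case
  proof cases
    case 1
    then have "?P n = {}" by (auto dest: prime_gt_0_nat)
    then show ?thesis by (simp only: prod.empty) simp
  next
    case 2
    then have "?P n = {}" by (auto dest: prime_ge_2_nat)
    then show ?thesis by (simp only: prod.empty) simp
  next
    case 3
    then have "?P n = {2}" by (auto dest: prime_ge_2_nat)
    then show ?thesis using 3 by simp
  next
    case 4
    have "\<not> prime n"
      using 4 by (metis less_irrefl_nat prime_odd_nat)
    then have "?P n = ?P (n - 1)"
      using 4 by (auto simp: le_less)
    moreover have "\<Prod>(?P (n - 1)) \<le> 4 ^ (n - 1)"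
      using less.IH[of "n - 1"] 4 by simp
    moreover have "(4::nat) ^ (n - 1) \<le> 4 ^ n"
      by (rule power_increasing) auto
    ultimately show ?thesis
      by (metis le_trans)
  next
    case 5
    let ?Q = "{p. prime p \<and> k + 1 < p \<and> p \<le> n}"
    let ?C = "n choose k"
    have "?P n = ?P (k + 1) \<union> ?Q"
      using 5 by auto
    then have "\<Prod>(?P n) = \<Prod>(?P (k + 1)) * \<Prod>?Q"
      using fin[of "k+1"] fin[of n] by (simp only:) (rule prod.union_disjoint, auto)
    moreover have "\<Prod>?Q \<le> 4 ^ k"
    proof -
      \<comment> \<open>As \<open>p > k + 1 = n - k\<close>, the prime divides \<open>fact n\<close>
        but neither factorial in the denominator.\<close>
      have "p dvd ?C" if "p \<in> ?Q" for p
      proof -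
        have "p dvd fact n"
          using that by (auto simp: prime_dvd_fact_iff)
        then have "p dvd fact k * fact (n - k) * ?C"
          using binomial_fact_lemma[of k n] 5 by simp
        moreover have "\<not> p dvd fact k" "\<not> p dvd fact (n - k)"
          using that 5 by (auto simp: prime_dvd_fact_iff simp del: fact_Suc)
        ultimately show ?thesis
          using that by (simp add: prime_dvd_mult_iff)
      qed
      moreover have "finite ?Q"
        using fin[of n] by (rule rev_finite_subset) auto
      ultimately have "\<Prod>?Q dvd ?C"
        by (intro prod_primes_dvd) auto
      moreover have "?C \<le> 4 ^ k"
      proof -
        \<comment> \<open>The two middle entries of an odd row are equal, and together they are at
          most the row sum.\<close>
        have "2 * ?C = (n choose k) + (n choose Suc k)"
          using binomial_symmetric[of k n] 5 by simp
        also have "\<dots> = (\<Sum>i\<in>{k, Suc k}. n choose i)"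
          by simp
        also have "\<dots> \<le> (\<Sum>i\<le>n. n choose i)"
          using 5 by (intro sum_mono2) auto
        also have "\<dots> = 2 ^ n"
          by (rule choose_row_sum)
        also have "\<dots> = 2 * 4 ^ k"
          using 5 by (simp add: power_mult)
        finally show ?thesis
          by simp
      qed
      moreover have "?C > 0"
        using 5 by simp
      ultimately show ?thesis
        using dvd_imp_le le_trans by blast
    qed
    moreover have "\<Prod>(?P (k + 1)) \<le> 4 ^ (k + 1)"
      using less.IH[of "k + 1"] 5 by simp
    ultimately have "\<Prod>(?P n) \<le> 4 ^ (k + 1) * 4 ^ k"
      by (simp only: mult_le_mono)
    moreover have "n = (k + 1) + k"
      using 5 by simp
    ultimately show ?thesis
      by (simp only: power_add)
  qed
qed

section \<open>A prime within a constant factor of every positive number\<close>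

text \<open>Write \<open>N = 4m\<^sup>2\<close>. Without such a prime, \<open>lcm(1, \<dots>, N) \<le> N\<^bsup>2m\<^esup> 4\<^bsup>m\<^sup>2\<^esup>\<close>, since primes above \<open>2m\<close>
  divide it only once; but it is at least the central binomial coefficient \<open>N choose 2m\<^sup>2\<close>.\<close>
lemma ex_prime_between_squares:
  "\<forall>\<^sub>F m in sequentially. \<exists>p. prime p \<and> m\<^sup>2 < p \<and> p \<le> 4 * (m::nat)\<^sup>2"
proof -
  \<comment> \<open>The left side will bound the \<open>Lcm\<close> from above, the right side the
    central binomial coefficient from below.\<close>
  have "\<forall>\<^sub>F m in sequentially.
          4 ^ m\<^sup>2 * (4 * (real m)\<^sup>2) ^ (2 * m) < 4 ^ (2 * m\<^sup>2) / (4 * (real m)\<^sup>2)"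
  proof -
    \<comment> \<open>On the logarithmic scale \<open>(2 * m + 1) * ln N < m^2 * ln 4\<close> is
      needed. Since \<open>2 * m + 1 \<le> 3 * m\<close>, this inequality, multiplied by
      \<open>m\<close>, suffices.\<close>
    have "\<forall>\<^sub>F m in sequentially. real m * ln 4 > 3 * ln (4 * (real m)\<^sup>2)"
      by real_asymp
    moreover have "\<forall>\<^sub>F m in sequentially. (m::nat) > 0"
      by (rule eventually_gt_at_top)
    ultimately show ?thesis
    proof eventually_elim
      case (elim m)
      let ?N = "4 * (real m)\<^sup>2"
      have "(2 * real m + 1) * ln ?N \<le> real m * (3 * ln ?N)"
      proof -
        have "2 * real m + 1 \<le> real m * 3"
          using elim by linarith
        moreover have "ln ?N \<ge> 0"
          using elim one_le_power[of "2 * real m" 2] by (intro ln_ge_zero) (simp add: power_mult_distrib)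
        ultimately have "(2 * real m + 1) * ln ?N \<le> real m * 3 * ln ?N"
          by (rule mult_right_mono)
        then show ?thesis
          by (simp only: mult.assoc)
      qed
      also have "\<dots> < real m * (real m * ln 4)"
        using elim by simp
      finally have "(2 * real m + 1) * ln ?N < real m * (real m * ln 4)" .
      moreover have "ln (?N ^ (2 * m + 1)) = (2 * real m + 1) * ln ?N"
        by (subst ln_realpow) (use elim in auto)
      moreover have "ln (4 ^ m\<^sup>2) = real m * (real m * ln 4)"
        by (subst ln_realpow) (auto simp: power2_eq_square)
      ultimately have "ln (?N ^ (2 * m + 1)) < ln (4 ^ m\<^sup>2)"
        by simp
      then have "?N ^ (2 * m + 1) < 4 ^ m\<^sup>2"
        using elim by (subst (asm) ln_less_cancel_iff) auto
      then have "4 ^ m\<^sup>2 * ?N ^ (2 * m + 1) < 4 ^ m\<^sup>2 * 4 ^ m\<^sup>2"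
        by simp
      moreover have "4 ^ (2 * m\<^sup>2) = (4::real) ^ m\<^sup>2 * 4 ^ m\<^sup>2"
        by (simp only: mult_2 power_add)
      moreover have "?N > 0"
        using elim by simp
      moreover have "?N ^ (2 * m + 1) = ?N ^ (2 * m) * ?N"
        by (simp only: power_add power_one_right)
      ultimately show ?case
        by (simp only: pos_less_divide_eq mult.assoc)
    qed
  qed
  moreover have "\<forall>\<^sub>F m in sequentially. (m::nat) > 0"
    by (rule eventually_gt_at_top)
  ultimately show ?thesis
  proof eventually_elim
    case (elim m)
    show ?case
    proof (rule ccontr)
      assume no: "\<not> ?thesis"
      let ?N = "4 * m\<^sup>2" and ?n = "m\<^sup>2"
      let ?L = "Lcm {1..?N}"
      let ?A = "{p \<in> prime_factors ?L. p \<le> 2 * m}" and ?B = "{p \<in> prime_factors ?L. 2 * m < p}"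
      have L0: "?L \<noteq> 0"
        by (auto simp: Lcm_0_iff)
      have N1: "?N \<ge> 1"
        using elim by simp
      have power_le: "p ^ multiplicity p ?L \<le> ?N" if "p \<in> prime_factors ?L" for p
        using that N1 by (intro prime_power_dvd_Lcm_imp_le multiplicity_dvd) auto
      \<comment> \<open>Prime factors are at most \<open>4 * m^2\<close>, and the negated goal
        leaves no prime between \<open>m^2\<close> and that bound.\<close>
      have le_n: "p \<le> ?n" if p: "p \<in> prime_factors ?L" for p
      proof -
        have "p ^ 1 dvd ?L"
          using p by auto
        then have "p \<le> ?N"
          using prime_power_dvd_Lcm_imp_le[of p 1 ?N] p N1 by auto
        then show ?thesis
          using no p by (meson in_prime_factors_iff not_le)
      qed
      have power_le': "p ^ multiplicity p ?L \<le> p" if p: "p \<in> ?B" for p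
      proof -
        have "\<not> multiplicity p ?L \<ge> 2"
        proof
          assume "multiplicity p ?L \<ge> 2"
          then have "p ^ 2 \<le> p ^ multiplicity p ?L"
            using p by (intro power_increasing) (auto dest: prime_ge_1_nat)
          also have "\<dots> \<le> ?N"
            using p power_le by auto
          finally have "p\<^sup>2 \<le> (2 * m)\<^sup>2"
            by (simp add: power_mult_distrib)
          then show False
            using p by (simp only: power2_nat_le_eq_le) auto
        qed
        then have "multiplicity p ?L \<le> 1"
          by simp
        then have "p ^ multiplicity p ?L \<le> p ^ 1"
          using p by (intro power_increasing) (auto dest: prime_ge_1_nat)
        then show ?thesis
          by simp
      qed
      have "?L = (\<Prod>p\<in>prime_factors ?L. p ^ multiplicity p ?L)"
        by (rule prime_factorization_nat) (use L0 in \<open>simp only: neq0_conv\<close>)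
      also have "prime_factors ?L = ?A \<union> ?B"
        by auto
      also have "(\<Prod>p\<in>?A \<union> ?B. p ^ multiplicity p ?L)
          = (\<Prod>p\<in>?A. p ^ multiplicity p ?L) * (\<Prod>p\<in>?B. p ^ multiplicity p ?L)"
        by (rule prod.union_disjoint) auto
      also have "\<dots> \<le> ?N ^ (2 * m) * 4 ^ ?n"
      proof (rule mult_le_mono)
        have "(\<Prod>p\<in>?A. p ^ multiplicity p ?L) \<le> (\<Prod>p\<in>?A. ?N)"
          by (intro prod_mono conjI zero_le power_le) blast
        also have "\<dots> = ?N ^ card ?A"
          by simp
        also have "card ?A \<le> card {1..2*m}"
          by (rule card_mono) (auto intro!: Suc_leI prime_gt_0_nat dest: in_prime_factors_imp_prime)
        then have "?N ^ card ?A \<le> ?N ^ (2 * m)"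
          using N1 by (intro power_increasing) auto
        finally show "(\<Prod>p\<in>?A. p ^ multiplicity p ?L) \<le> ?N ^ (2 * m)" .
        have "(\<Prod>p\<in>?B. p ^ multiplicity p ?L) \<le> \<Prod>?B"
          by (intro prod_mono conjI zero_le power_le')
        also have "\<dots> \<le> \<Prod>{p. prime p \<and> p \<le> ?n}"
        proof (rule dvd_imp_le)
          show "\<Prod>?B dvd \<Prod>{p. prime p \<and> p \<le> ?n}"
          proof (rule prod_dvd_prod_subset)
            show "finite {p. prime p \<and> p \<le> ?n}"
              by (rule finite_subset[of _ "{..?n}"]) auto
            show "?B \<subseteq> {p. prime p \<and> p \<le> ?n}"
              using le_n in_prime_factors_imp_prime by blast
          qed
          show "\<Prod>{p::nat. prime p \<and> p \<le> ?n} > 0"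
            by (rule prod_pos) (auto dest: prime_gt_0_nat)
        qed
        also have "\<dots> \<le> 4 ^ ?n"
          by (rule prod_primes_le)
        finally show "(\<Prod>p\<in>?B. p ^ multiplicity p ?L) \<le> 4 ^ ?n" .
      qed
      finally have up: "?L \<le> ?N ^ (2 * m) * 4 ^ ?n" .
      have "2 * ?n * ((2 * (2 * ?n)) choose (2 * ?n)) dvd ?L"
        using mult_binomial_dvd_Lcm[of "2 * ?n" "?N"] elim by simp
      then have "2 * ?n * ((2 * (2 * ?n)) choose (2 * ?n)) \<le> ?L"
        by (rule dvd_imp_le) (use L0 in \<open>simp only: neq0_conv\<close>)
      moreover have "1 * ((2 * (2 * ?n)) choose (2 * ?n)) \<le> 2 * ?n * ((2 * (2 * ?n)) choose (2 * ?n))"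
        using elim by (intro mult_le_mono1) simp
      ultimately have "real ((2 * (2 * ?n)) choose (2 * ?n)) \<le> real ?L"
        by linarith
      moreover have "4 ^ (2 * ?n) / (2 * real (2 * ?n)) \<le> real ((2 * (2 * ?n)) choose (2 * ?n))"
        by (rule central_binomial_lower_bound) (use elim in simp)
      moreover have "real ?L \<le> real (?N ^ (2 * m) * 4 ^ ?n)"
        using up by (rule of_nat_mono)
      ultimately show False
        using elim by (simp add: mult.commute)
    qed
  qed
qed

text \<open>The least square \<open>m^2 > n\<close> is at most \<open>4 * n\<close>, so for large
  \<open>n\<close> a prime between \<open>m^2\<close> and \<open>4 * m^2\<close> is at most
  \<open>16 * n\<close>. All \<open>n \<le> M^2\<close> are served by one fixed prime
  \<open>q > M^2\<close>; hence \<open>K = max 16 q\<close>.\<close>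

lemma ex_prime_linear:
  "\<exists>K::nat. \<forall>n\<ge>1. \<exists>p. prime p \<and> n \<le> p \<and> p \<le> K * n"
proof -
  obtain M where M: "\<And>m. m \<ge> M \<Longrightarrow> \<exists>p. prime p \<and> m\<^sup>2 < p \<and> p \<le> 4 * (m::nat)\<^sup>2"
    using ex_prime_between_squares unfolding eventually_sequentially by blast
  obtain q :: nat where q: "prime q" "q > M\<^sup>2"
    using bigger_prime by blast
  have "\<exists>p. prime p \<and> n \<le> p \<and> p \<le> max 16 q * n" if n: "n \<ge> 1" for n
  proof (cases "n \<le> M\<^sup>2")
    case True
    then show ?thesis
      using q n by (intro exI[of _ q]) (auto intro: order.trans[of _ "q * n"])
  next
    case False
    define m where "m = Suc (floor_sqrt n)"
    have "n \<le> m\<^sup>2"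
      unfolding m_def using Suc_floor_sqrt_power2_gt[of n] by simp
    have "floor_sqrt n > 0"
      using n by simp
    then have "m \<le> 2 * floor_sqrt n"
      unfolding m_def by linarith
    then have "m\<^sup>2 \<le> (2 * floor_sqrt n)\<^sup>2"
      by (rule power_mono) simp
    also have "\<dots> \<le> 4 * n"
      by (simp add: power_mult_distrib)
    finally have "m\<^sup>2 \<le> 4 * n" .
    have "M\<^sup>2 < m\<^sup>2"
      using \<open>n \<le> m\<^sup>2\<close> False by linarith
    then have "m \<ge> M"
      using power2_less_imp_less less_imp_le by blast
    then obtain p where p: "prime p" "m\<^sup>2 < p" "p \<le> 4 * m\<^sup>2"
      using M by blast
    have "16 * n \<le> max 16 q * n"
      by (intro mult_le_mono1) simp
    then have "n \<le> p \<and> p \<le> max 16 q * n"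
      using p \<open>n \<le> m\<^sup>2\<close> \<open>m\<^sup>2 \<le> 4 * n\<close> by linarith
    then show ?thesis
      using p by blast
  qed
  then show ?thesis
    by blast
qed

section \<open>Drawings from track layouts\<close>

definition moment_point :: "nat \<Rightarrow> nat \<Rightarrow> nat \<Rightarrow> real ^ 3" where
  "moment_point p c h = vector [real c, real (c\<^sup>2 mod p), real (p * h + c ^ 3 mod p)]"

lemma moment_point_nth:
  "moment_point p c h $ 1 = real c"
  "moment_point p c h $ 2 = real (c\<^sup>2 mod p)"
  "moment_point p c h $ 3 = real p * real h + real (c ^ 3 mod p)"
  by (simp_all add: moment_point_def)

lemma dvd_diff_less_imp_eq:
  assumes "int p dvd int a - int b" and "a < p" and "b < p"
  shows "a = b"
proof (rule ccontr)
  assume "a \<noteq> b"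
  then have "\<bar>int p\<bar> \<le> \<bar>int a - int b\<bar>"
    using assms by (intro dvd_imp_le_int) auto
  then show False
    using assms by linarith
qed

text \<open>Generic in the ring, so that real determinants of lattice points can be carried over to
  \<open>int\<close> and studied modulo \<open>p\<close>.\<close>

abbreviation det2 :: "'a::comm_ring \<Rightarrow> 'a \<Rightarrow> 'a \<Rightarrow> 'a \<Rightarrow> 'a" where
  "det2 a b c d \<equiv> a * d - b * c"

abbreviation det3 :: "'a::comm_ring \<Rightarrow> 'a \<Rightarrow> 'a \<Rightarrow> 'a \<Rightarrow> 'a \<Rightarrow> 'a \<Rightarrow> 'a \<Rightarrow> 'a \<Rightarrow> 'a \<Rightarrow> 'a" where
  "det3 a1 a2 a3 b1 b2 b3 c1 c2 c3 \<equiv>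
     a1 * det2 b2 b3 c2 c3 - a2 * det2 b1 b3 c1 c3 + a3 * det2 b1 b2 c1 c2"

text \<open>Modulo \<open>p\<close> the determinant is \<open>(b - a) * (c - a) * (c - b)\<close>,
  whose factors are nonzero modulo \<open>p\<close>. Only the horizontal projection is involved, so
  height 0 stands for any height.\<close>

lemma moment_point_noncollinear:
  fixes a b c :: nat
  assumes "prime p" and lt: "a < p" "b < p" "c < p" and ne: "a \<noteq> b" "a \<noteq> c" "b \<noteq> c"
  defines "y \<equiv> \<lambda>i. moment_point p i 0 $ 2"
  shows "det2 (real b - real a) (real c - real a) (y b - y a) (y c - y a) \<noteq> 0"
proof
  define Y K where "Y = (\<lambda>i. int (i\<^sup>2 mod p))" and "K = (\<lambda>i. int (i\<^sup>2 div p))"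
  have Y: "Y i = int i ^ 2 - int p * K i" for i
    unfolding Y_def K_def by (simp add: zmod_int zdiv_int minus_mult_div_eq_mod)
  have y: "y i = of_int (Y i)" for i
    by (simp add: y_def Y_def moment_point_nth)
  assume "det2 (real b - real a) (real c - real a) (y b - y a) (y c - y a) = 0"
  then have "of_int (det2 (int b - int a) (int c - int a) (Y b - Y a) (Y c - Y a)) = (0::real)"
    unfolding y by simp
  then have "det2 (int b - int a) (int c - int a) (Y b - Y a) (Y c - Y a) = 0"
    by (simp only: of_int_eq_0_iff)
  then have "(int b - int a) * (int c - int a) * (int c - int b)
      = int p * det2 (int b - int a) (int c - int a) (K b - K a) (K c - K a)"
    unfolding Y by algebra
  then have "int p dvd (int b - int a) * (int c - int a) * (int c - int b)"
    by (rule dvdI)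
  then show False
    using assms(1) lt ne
    by (auto simp: prime_dvd_mult_iff dest!: dvd_diff_less_imp_eq)
qed

text \<open>The Vandermonde determinant of order 4, after the row of \<open>a\<close> has been
  subtracted from the others.\<close>

lemma det3_Vandermonde:
  fixes a b c d :: int
  shows "det3 (b - a) (b\<^sup>2 - a\<^sup>2) (b ^ 3 - a ^ 3) (c - a) (c\<^sup>2 - a\<^sup>2) (c ^ 3 - a ^ 3)
           (d - a) (d\<^sup>2 - a\<^sup>2) (d ^ 3 - a ^ 3)
       = (b - a) * (c - a) * (d - a) * (c - b) * (d - b) * (d - c)"
  by (simp add: algebra_simps power2_eq_square power3_eq_cube)

text \<open>Linearity in the second and then the third column; it serves to discard multiples of
  \<open>p\<close>.\<close>

lemma det3_diff_multiples:
  fixes p :: int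
  shows "det3 a1 (a2 - p * k1) (a3 - p * l1) b1 (b2 - p * k2) (b3 - p * l2) c1 (c2 - p * k3) (c3 - p * l3)
    = det3 a1 a2 a3 b1 b2 b3 c1 c2 c3 - p * (det3 a1 k1 a3 b1 k2 b3 c1 k3 c3
        + det3 a1 (a2 - p * k1) l1 b1 (b2 - p * k2) l2 c1 (c2 - p * k3) l3)"
  by (simp add: algebra_simps)

text \<open>Modulo \<open>p\<close>, the determinant is the Vandermonde determinant of \<open>a\<close>, \<open>b\<close>, \<open>c\<close>, \<open>d\<close>.\<close>
lemma moment_point_noncoplanar:
  fixes a b c d i j k l :: nat
  assumes "prime p" and lt: "a < p" "b < p" "c < p" "d < p"
    and ne: "a \<noteq> b" "a \<noteq> c" "a \<noteq> d" "b \<noteq> c" "b \<noteq> d" "c \<noteq> d"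
  defines "B \<equiv> moment_point p b j - moment_point p a i"
    and "C \<equiv> moment_point p c k - moment_point p a i" and "D \<equiv> moment_point p d l - moment_point p a i"
  shows "det3 (B $ 1) (B $ 2) (B $ 3) (C $ 1) (C $ 2) (C $ 3) (D $ 1) (D $ 2) (D $ 3) \<noteq> 0"
proof
  define K where "K i = int (i\<^sup>2 div p)" for i
  \<comment> \<open>\<open>L\<close> absorbs the height, which changes the third coordinate only by
    a multiple of \<open>p\<close>.\<close>
  define L where "L i h = int (i ^ 3 div p) - int h" for i h
  have y: "moment_point p i h $ 2 = of_int (int i ^ 2 - int p * K i)" for i h
  proof -
    have "int (i\<^sup>2 mod p) = int i ^ 2 - int p * K i"
      unfolding K_def by (simp add: zmod_int zdiv_int minus_mult_div_eq_mod)
    then show ?thesis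
      by (metis moment_point_nth(2) of_int_of_nat_eq)
  qed
  have z: "moment_point p i h $ 3 = of_int (int i ^ 3 - int p * L i h)" for i h
  proof -
    have "int (i ^ 3 mod p) = int i ^ 3 - int p * int (i ^ 3 div p)"
      by (simp add: zmod_int zdiv_int minus_mult_div_eq_mod)
    then have "int p * int h + int (i ^ 3 mod p) = int i ^ 3 - int p * L i h"
      unfolding L_def by (simp add: algebra_simps)
    moreover have "moment_point p i h $ 3 = of_int (int p * int h + int (i ^ 3 mod p))"
      by (simp add: moment_point_nth)
    ultimately show ?thesis
      by simp
  qed
  have x: "moment_point p i h $ 1 = of_int (int i)" for i h
    by (simp add: moment_point_nth)
  \<comment> \<open>Brings coordinate differences into the shape \<open>x - p * k\<close> required
    by \<open>det3_diff_multiples\<close>.\<close>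
  have *: "int u ^ m - int p * k - (int v ^ m - int p * l) = (int u ^ m - int v ^ m) - int p * (k - l)"
    for u v m k l
    by (simp add: algebra_simps)
  assume "det3 (B $ 1) (B $ 2) (B $ 3) (C $ 1) (C $ 2) (C $ 3) (D $ 1) (D $ 2) (D $ 3) = 0"
  then have "int p dvd (int b - int a) * (int c - int a) * (int d - int a) * (int c - int b)
      * (int d - int b) * (int d - int c)"
    unfolding B_def C_def D_def vector_minus_component x y z
      of_int_mult[symmetric] of_int_diff[symmetric] of_int_add[symmetric] of_int_eq_0_iff
      * det3_diff_multiples det3_Vandermonde
    by (metis dvd_triv_left eq_iff_diff_eq_0)
  then show False
    using assms(1) lt ne
    by (auto simp: prime_dvd_mult_iff dest!: dvd_diff_less_imp_eq)
qed

section \<open>Linear algebra for intersecting segments\<close>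

lemma in_closed_segment_nth:
  fixes a b q :: "real ^ 'n"
  assumes "q \<in> closed_segment a b"
  obtains s where "0 \<le> s" and "s \<le> 1" and "\<And>i. q $ i = a $ i + s * (b $ i - a $ i)"
proof -
  from assms obtain s where "0 \<le> s" "s \<le> 1" "q = (1 - s) *\<^sub>R a + s *\<^sub>R b"
    by (auto simp: in_segment)
  then show ?thesis
    by (intro that[of s]) (simp_all add: left_diff_distrib right_diff_distrib)
qed

text \<open>Cramer's rule; it will be applied to two edges that leave the same track towards
  different tracks.\<close>

lemma det2_eq_zero_imp:
  fixes s r :: real
  assumes "s * a = r * c" and "s * b = r * d" and "det2 a c b d \<noteq> 0"
  shows "s = 0 \<and> r = 0"
proof -
  have "s * det2 a c b d = 0" "r * det2 a c b d = 0"
    using assms(1,2) by algebra+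
  with assms(3) show ?thesis
    by simp
qed

text \<open>The linear relation between the rows is nontrivial because \<open>r\<close> and
  \<open>1 - r\<close> are not both 0; substituting it shows that both annihilate the
  determinant.\<close>

lemma det3_eq_zero_if_dependent:
  fixes s r :: real
  assumes "s * a1 = (1 - r) * b1 + r * c1" and "s * a2 = (1 - r) * b2 + r * c2"
    and "s * a3 = (1 - r) * b3 + r * c3"
  shows "det3 a1 a2 a3 b1 b2 b3 c1 c2 c3 = 0"
proof -
  let ?D = "det3 a1 a2 a3 b1 b2 b3 c1 c2 c3"
  have r: "r * c1 = s * a1 - (1 - r) * b1" "r * c2 = s * a2 - (1 - r) * b2" "r * c3 = s * a3 - (1 - r) * b3"
    and r': "(1 - r) * b1 = s * a1 - r * c1" "(1 - r) * b2 = s * a2 - r * c2" "(1 - r) * b3 = s * a3 - r * c3"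
    using assms by simp_all
  have "r * ?D = det3 a1 a2 a3 b1 b2 b3 (r * c1) (r * c2) (r * c3)"
    by (simp add: algebra_simps)
  also have "\<dots> = 0"
    unfolding r by (simp add: algebra_simps)
  finally have "r * ?D = 0" .
  moreover have "(1 - r) * ?D = det3 a1 a2 a3 ((1 - r) * b1) ((1 - r) * b2) ((1 - r) * b3) c1 c2 c3"
    by (simp add: algebra_simps)
  moreover have "\<dots> = 0"
    unfolding r' by (simp add: algebra_simps)
  ultimately show ?thesis
    by (cases "r = 0") simp_all
qed

text \<open>The hypothesis \<open>mono\<close> excludes X-crossings; its conclusion is not strict
  because two edges may share an end-vertex.\<close>

proposition drawing_3d_moment_point:
  fixes G :: "'a pair_pre_digraph" and col h :: "'a \<Rightarrow> nat"
  assumes "pair_graph G" and p: "prime p" and lt: "\<And>v. v \<in> pverts G \<Longrightarrow> col v < p"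
    and inj: "\<And>u v. u \<in> pverts G \<Longrightarrow> v \<in> pverts G \<Longrightarrow> col u = col v \<Longrightarrow> h u = h v \<Longrightarrow> u = v"
    and proper: "\<And>u v. (u, v) \<in> parcs G \<Longrightarrow> col u \<noteq> col v"
    and mono: "\<And>u v x y. (u, v) \<in> parcs G \<Longrightarrow> (x, y) \<in> parcs G \<Longrightarrow> col u = col x \<Longrightarrow>
        col v = col y \<Longrightarrow> h u < h x \<Longrightarrow> h v \<le> h y"
  shows "drawing_3d G (\<lambda>v. moment_point p (col v) (h v))"
proof -
  interpret pair_graph G by fact
  define P where "P v = moment_point p (col v) (h v)" for v
  have p0: "p > 0"
    using p prime_gt_0_nat by blast
  have P1: "P v $ 1 = real (col v)" for v
    by (simp add: P_def moment_point_nth)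
  have P2: "P v $ 2 = moment_point p (col v) 0 $ 2" for v
    by (simp add: P_def moment_point_nth)
  have P_eqI: "P u = P v" if "col u = col v" "h u = h v" for u v
    using that by (simp add: P_def)
  have inj_P: "inj_on P (pverts G)"
  proof (rule inj_onI)
    fix u v assume uv: "u \<in> pverts G" "v \<in> pverts G" "P u = P v"
    then have "P u $ 1 = P v $ 1" "P u $ 3 = P v $ 3"
      by simp_all
    then show "u = v"
      using uv inj p0 by (simp add: P_def moment_point_nth)
  qed
  have verts: "u \<in> pverts G" "v \<in> pverts G" if "(u, v) \<in> parcs G" for u v
    using that in_arcsD1 in_arcsD2 by auto
  have sym: "(v, u) \<in> parcs G" if "(u, v) \<in> parcs G" for u v
    using that by (rule arcs_symmetric)
  have noncollinear: "det2 (P v $ 1 - P u $ 1) (P w $ 1 - P u $ 1) (P v $ 2 - P u $ 2) (P w $ 2 - P u $ 2) \<noteq> 0"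
    if "u \<in> pverts G" "v \<in> pverts G" "w \<in> pverts G"
      "col u \<noteq> col v" "col u \<noteq> col w" "col v \<noteq> col w" for u v w
    unfolding P1 P2 using that p lt by (intro moment_point_noncollinear) auto

  have vertex_end: "w = u" if uv: "(u, v) \<in> parcs G" and w: "w \<in> pverts G" "col w = col u"
    and seg: "P w \<in> closed_segment (P u) (P v)" for u v w
  proof -
    obtain s where s: "\<And>i. P w $ i = P u $ i + s * (P v $ i - P u $ i)"
      using seg in_closed_segment_nth by blast
    \<comment> \<open>The first coordinates of \<open>w\<close> and \<open>u\<close> agree, while
      those of \<open>u\<close> and \<open>v\<close> differ.\<close>
    have "s = 0"
      using s[of 1] proper[OF uv] w by (simp add: P1)
    then have "P w = P u"
      using s by (simp add: vec_eq_iff)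
    then show ?thesis
      using inj_P uv verts w by (auto dest: inj_onD)
  qed
  have vertex: "w \<in> {u, v}" if uv: "(u, v) \<in> parcs G" and w: "w \<in> pverts G"
    and seg: "P w \<in> closed_segment (P u) (P v)" for u v w
  proof (rule ccontr)
    assume "w \<notin> {u, v}"
    then have ne: "col w \<noteq> col u" "col w \<noteq> col v"
      using vertex_end[OF uv w] vertex_end[OF sym[OF uv] w] seg
      by (auto simp: closed_segment_commute)
    obtain s where s: "\<And>i. P w $ i = P u $ i + s * (P v $ i - P u $ i)"
      using seg in_closed_segment_nth by blast
    have "det2 (P v $ 1 - P u $ 1) (P w $ 1 - P u $ 1) (P v $ 2 - P u $ 2) (P w $ 2 - P u $ 2) = 0"
      using s[of 1] s[of 2] by algebra
    then show False
      using noncollinear[of u v w] uv verts w ne proper by metis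
  qed

  have common: "q \<in> P ` ({u, v} \<inter> {x, y})"
    if uv: "(u, v) \<in> parcs G" and xy: "(x, y) \<in> parcs G" and ne: "{u, v} \<noteq> {x, y}"
      and q: "q \<in> closed_segment (P u) (P v)" "q \<in> closed_segment (P x) (P y)"
      and ux: "col u = col x" for u v x y q
  proof -
    obtain s where s: "0 \<le> s" "s \<le> 1" "\<And>i. q $ i = P u $ i + s * (P v $ i - P u $ i)"
      using q(1) in_closed_segment_nth by blast
    obtain r where r: "0 \<le> r" "r \<le> 1" "\<And>i. q $ i = P x $ i + r * (P y $ i - P x $ i)"
      using q(2) in_closed_segment_nth by blast
    have P12: "P x $ 1 = P u $ 1" "P x $ 2 = P u $ 2"
      using ux by (simp_all add: P1 P2)
    show ?thesis
    proof (cases "col v = col y")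
      case False
      \<comment> \<open>Seen from above, both edges start at the same point in independent
        directions, so they can only meet there.\<close>
      have "s * (P v $ 1 - P u $ 1) = r * (P y $ 1 - P u $ 1)"
        "s * (P v $ 2 - P u $ 2) = r * (P y $ 2 - P u $ 2)"
        using s(3)[of 1] r(3)[of 1] s(3)[of 2] r(3)[of 2] P12 by simp_all
      then have "s = 0 \<and> r = 0"
        using det2_eq_zero_imp noncollinear[of u v y] uv xy verts proper ux False by metis
      then have "q = P u" "q = P x"
        using s(3) r(3) by (simp_all add: vec_eq_iff)
      then have "u = x"
        using inj_P uv xy verts by (auto dest: inj_onD)
      then show ?thesis
        using \<open>q = P u\<close> by simp
    next
      case True
      \<comment> \<open>Seen from above, both edges are now the same segment, so the parameters
        agree.\<close>
      have "s * (P v $ 1 - P u $ 1) = r * (P v $ 1 - P u $ 1)"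
        using s(3)[of 1] r(3)[of 1] ux True by (auto simp: P1)
      then have rs: "r = s"
        using proper[OF uv] by (simp add: P1)
      \<comment> \<open>The cubic residues cancel because the tracks agree; what remains is the
        vertical gap between the edges at parameter \<open>s\<close>.\<close>
      have "real p * ((1 - s) * (real (h u) - real (h x)) + s * (real (h v) - real (h y))) = 0"
        using s(3)[of 3] r(3)[of 3] ux True rs by (simp add: P_def moment_point_nth algebra_simps)
      then have eq: "(1 - s) * (real (h u) - real (h x)) + s * (real (h v) - real (h y)) = 0"
        using p0 by simp
      have u_eq: "u = x" if "h u = h x"
        using that inj uv xy verts ux by metis
      have v_eq: "v = y" if "h v = h y"
        using that inj uv xy verts True by metis
      have start: "q = P u" if "s = 0"
        using s(3) that by (simp add: vec_eq_iff)
      have end': "q = P v" if "s = 1"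
        using s(3) that by (simp add: vec_eq_iff)
      \<comment> \<open>By \<open>mono\<close> the two summands of \<open>eq\<close> have the same
        sign, so both vanish: the first gives \<open>s = 1\<close>, and then the second gives
        \<open>v = y\<close>.\<close>
      have vy: "v = y \<and> s = 1" if "h u \<noteq> h x"
      proof -
        have "(1 - s) * (real (h u) - real (h x)) = 0 \<and> s * (real (h v) - real (h y)) = 0"
        proof (cases "h u < h x")
          case True
          then have "h v \<le> h y"
            using mono uv xy ux \<open>col v = col y\<close> by blast
          then have "(1 - s) * (real (h u) - real (h x)) \<le> 0" "s * (real (h v) - real (h y)) \<le> 0"
            using True s by (auto intro!: mult_nonneg_nonpos)
          then show ?thesis
            using eq by linarith
        next
          case False
          then have "h y \<le> h v"
            using mono[OF xy uv] ux \<open>col v = col y\<close> that by simp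
          then have "(1 - s) * (real (h u) - real (h x)) \<ge> 0" "s * (real (h v) - real (h y)) \<ge> 0"
            using False s by auto
          then show ?thesis
            using eq by linarith
        qed
        then show ?thesis
          using that v_eq by auto
      qed
      show ?thesis
      proof (cases "h u = h x")
        case True
        \<comment> \<open>Different edges with \<open>u = x\<close> have
          \<open>v \<noteq> y\<close>, so the second summand of \<open>eq\<close> forces
          \<open>s = 0\<close>.\<close>
        then have "u = x" "v \<noteq> y"
          using u_eq ne by auto
        then have "s = 0"
          using eq v_eq by auto
        then show ?thesis
          using start \<open>u = x\<close> by simp
      next
        case False
        then show ?thesis
          using vy end' by auto
      qed
    qed
  qed
  have edges: "closed_segment (P u) (P v) \<inter> closed_segment (P x) (P y) \<subseteq> P ` ({u, v} \<inter> {x, y})"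
    if uv: "(u, v) \<in> parcs G" and xy: "(x, y) \<in> parcs G" and ne: "{u, v} \<noteq> {x, y}" for u v x y
  proof
    fix q assume "q \<in> closed_segment (P u) (P v) \<inter> closed_segment (P x) (P y)"
    then have q: "q \<in> closed_segment (P u) (P v)" "q \<in> closed_segment (P x) (P y)"
      and q': "q \<in> closed_segment (P v) (P u)" "q \<in> closed_segment (P y) (P x)"
      by (auto simp: closed_segment_commute)
    \<comment> \<open>If two ends share a track, reversing edges makes them the first ends, so that
      \<open>common\<close> applies. Otherwise the four tracks are distinct and the ends are not
      coplanar.\<close>
    consider "col u = col x" | "col u = col y" | "col v = col x" | "col v = col y"
      | "col u \<noteq> col x" "col u \<noteq> col y" "col v \<noteq> col x" "col v \<noteq> col y"
      by blast
    then show "q \<in> P ` ({u, v} \<inter> {x, y})"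
    proof cases
      case 1
      then show ?thesis using common[OF uv xy ne q] by blast
    next
      case 2
      then show ?thesis
        using common[OF uv sym[OF xy] _ q(1) q'(2)] ne by (simp add: insert_commute)
    next
      case 3
      then show ?thesis
        using common[OF sym[OF uv] xy _ q'(1) q(2)] ne by (simp add: insert_commute)
    next
      case 4
      then show ?thesis
        using common[OF sym[OF uv] sym[OF xy] _ q'] ne by (simp add: insert_commute)
    next
      case 5
      obtain s where s: "\<And>i. q $ i = P u $ i + s * (P v $ i - P u $ i)"
        using q(1) in_closed_segment_nth by blast
      obtain r where r: "\<And>i. q $ i = P x $ i + r * (P y $ i - P x $ i)"
        using q(2) in_closed_segment_nth by blast
      \<comment> \<open>With \<open>P u\<close> as origin, \<open>q\<close> is a multiple of
        \<open>P v - P u\<close> and an affine combination of the other two vectors.\<close>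
      have dep: "s * (P v - P u) $ i = (1 - r) * (P x - P u) $ i + r * (P y - P u) $ i" for i
        using s[of i] r[of i] by (simp add: algebra_simps)
      have "det3 ((P v - P u) $ 1) ((P v - P u) $ 2) ((P v - P u) $ 3)
          ((P x - P u) $ 1) ((P x - P u) $ 2) ((P x - P u) $ 3)
          ((P y - P u) $ 1) ((P y - P u) $ 2) ((P y - P u) $ 3) = 0"
        by (rule det3_eq_zero_if_dependent) (rule dep)+
      moreover have "det3 ((P v - P u) $ 1) ((P v - P u) $ 2) ((P v - P u) $ 3)
          ((P x - P u) $ 1) ((P x - P u) $ 2) ((P x - P u) $ 3)
          ((P y - P u) $ 1) ((P y - P u) $ 2) ((P y - P u) $ 3) \<noteq> 0"
        unfolding P_def
        by (rule moment_point_noncoplanar) (use p lt uv xy verts proper 5 in auto)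
      ultimately show ?thesis
        by contradiction
    qed
  qed
  have "P v $ i \<in> \<int>" for v i
    using exhaust_3[of i] by (auto simp: P_def moment_point_def)
  then show ?thesis
    unfolding drawing_3d_def P_def[symmetric] using inj_P vertex edges by blast
qed

section \<open>Track layouts with tracks of balanced size\<close>

definition rank_in :: "'a set \<Rightarrow> 'a rel \<Rightarrow> 'a \<Rightarrow> nat" where
  "rank_in V r v = card {x \<in> V. (x, v) \<in> r}"

lemma
  assumes "finite V" and "x \<in> V" and r: "strict_linear_order_on V r"
  shows rank_in_less_card: "rank_in V r x < card V"
    and rank_in_mono: "(x, y) \<in> r \<Longrightarrow> rank_in V r x < rank_in V r y"
proof -
  have irr: "(x, x) \<notin> r"
    using r by (auto simp: strict_linear_order_on_def irrefl_def)
  show "rank_in V r x < card V"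
    unfolding rank_in_def using assms irr by (intro psubset_card_mono) auto
  assume xy: "(x, y) \<in> r"
  have "trans r"
    using r by (simp add: strict_linear_order_on_def)
  then have "{z \<in> V. (z, x) \<in> r} \<subset> {z \<in> V. (z, y) \<in> r}"
    using xy irr assms by (auto dest: transD)
  then show "rank_in V r x < rank_in V r y"
    unfolding rank_in_def using assms by (intro psubset_card_mono) auto
qed

lemma rank_in_less_iff:
  assumes "finite V" and "x \<in> V" and "y \<in> V" and r: "strict_linear_order_on V r"
  shows "rank_in V r x < rank_in V r y \<longleftrightarrow> (x, y) \<in> r"
proof -
  have "x = y \<or> (x, y) \<in> r \<or> (y, x) \<in> r"
    using assms by (auto simp: strict_linear_order_on_def total_on_def)
  then show ?thesis
    using rank_in_mono[OF assms(1,2) r, of y] rank_in_mono[OF assms(1,3) r, of x]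
    by auto
qed

lemma rank_in_eq_imp_eq:
  assumes "finite V" and "x \<in> V" and "y \<in> V" and r: "strict_linear_order_on V r"
    and "rank_in V r x = rank_in V r y"
  shows "x = y"
proof -
  have "x = y \<or> (x, y) \<in> r \<or> (y, x) \<in> r"
    using assms by (auto simp: strict_linear_order_on_def total_on_def)
  then show ?thesis
    using assms rank_in_mono[OF assms(1,2) r, of y] rank_in_mono[OF assms(1,3) r, of x]
    by auto
qed

text \<open>Every track is cut into blocks of at most \<open>s = n div t + 1\<close> consecutive vertices.
  Since \<open>s t > n\<close>, this gives fewer than \<open>t\<close> full blocks and at most \<open>t\<close> other ones.\<close>
lemma track_layout_balance:
  fixes G :: "'a pair_pre_digraph"
  assumes "pair_graph G" and layout: "track_layout G t P lt" and "pverts G \<noteq> {}"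
  obtains col h :: "'a \<Rightarrow> nat" where
    "\<And>v. v \<in> pverts G \<Longrightarrow> col v < 2 * t"
    "\<And>v. h v < card (pverts G) div t + 1"
    "\<And>u v. u \<in> pverts G \<Longrightarrow> v \<in> pverts G \<Longrightarrow> col u = col v \<Longrightarrow> h u = h v \<Longrightarrow> u = v"
    "\<And>u v. (u, v) \<in> parcs G \<Longrightarrow> col u \<noteq> col v"
    "\<And>u v x y. (u, v) \<in> parcs G \<Longrightarrow> (x, y) \<in> parcs G \<Longrightarrow> col u = col x \<Longrightarrow>
        col v = col y \<Longrightarrow> h u < h x \<Longrightarrow> h v \<le> h y"
proof -
  interpret pair_graph G by fact
  let ?n = "card (pverts G)"
  define s where "s = ?n div t + 1"
  have part: "partition_on (pverts G) P" and col: "\<And>V u v. V \<in> P \<Longrightarrow> (u, v) \<in> parcs G \<Longrightarrow> u \<in> V \<Longrightarrow> v \<notin> V"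
    and lin: "\<And>V. V \<in> P \<Longrightarrow> strict_linear_order_on V (lt V)"
    and card_P: "card P = t" and noX: "\<not> X_crossing G P lt"
    using layout unfolding track_layout_def track_assignment_def colouring_def by blast+
  have fin_P: "finite P"
    using finite_elements[OF pair_finite_verts part] .
  have Un: "pverts G = \<Union>P" and dis: "disjoint P"
    using part by (auto simp: partition_on_def)
  have fin_V: "finite V" if "V \<in> P" for V
    using that Un pair_finite_verts by (metis Sup_upper finite_subset)
  have "t > 0"
    using card_P fin_P Un \<open>pverts G \<noteq> {}\<close> by (auto simp: card_gt_0_iff)
  have "\<forall>v\<in>pverts G. \<exists>V. V \<in> P \<and> v \<in> V"
    using Un by blast
  then obtain T where T: "\<And>v. v \<in> pverts G \<Longrightarrow> T v \<in> P \<and> v \<in> T v"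
    using bchoice[of "pverts G" "\<lambda>v V. V \<in> P \<and> v \<in> V"] by blast
  define rank where "rank v = rank_in (T v) (lt (T v)) v" for v
  define B where "B v = (T v, rank v div s)" for v
  have "card (B ` pverts G) \<le> 2 * t"
  proof -
    \<comment> \<open>The index \<open>card V div s\<close> is included for a last, incomplete
      block; this costs one extra block per track.\<close>
    have "B ` pverts G \<subseteq> Sigma P (\<lambda>V. {..card V div s})"
    proof
      fix b assume "b \<in> B ` pverts G"
      then obtain v where v: "v \<in> pverts G" "b = B v"
        by blast
      have "rank v < card (T v)"
        unfolding rank_def using T v by (auto intro!: rank_in_less_card fin_V lin)
      then have "rank v div s \<le> card (T v) div s"
        by (intro div_le_mono) simp
      then show "b \<in> Sigma P (\<lambda>V. {..card V div s})"
        using v T by (simp add: B_def)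
    qed
    then have "card (B ` pverts G) \<le> card (Sigma P (\<lambda>V. {..card V div s}))"
      using fin_P by (intro card_mono) auto
    also have "\<dots> = (\<Sum>V\<in>P. card V div s) + t"
      using fin_P card_P by (simp add: sum.distrib card_SigmaI flip: Suc_eq_plus1)
        (simp add: sum_Suc)
    also have "(\<Sum>V\<in>P. card V div s) < t"
    proof -
      have "s * (\<Sum>V\<in>P. card V div s) \<le> (\<Sum>V\<in>P. card V)"
        unfolding sum_distrib_left by (intro sum_mono) simp
      also have "\<dots> = ?n"
        unfolding Un using dis fin_V by (intro card_Union_disjoint[symmetric]) (auto simp: disjoint_def pairwise_def disjnt_def)
      also have "?n < s * t"
        using \<open>t > 0\<close> unfolding s_def by (metis dividend_less_div_times add.commute mult.commute mult_Suc plus_1_eq_Suc)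
      finally show ?thesis
        by simp
    qed
    finally show ?thesis
      by linarith
  qed
  \<comment> \<open>Numbering the blocks that occur by an initial segment of the naturals yields the
    colours.\<close>
  obtain f :: "'a set \<times> nat \<Rightarrow> nat" where f: "inj_on f (B ` pverts G)"
    "f ` (B ` pverts G) = {i. i < card (B ` pverts G)}"
  proof -
    have "finite (B ` pverts G)"
      using pair_finite_verts by simp
    then obtain f :: "'a set \<times> nat \<Rightarrow> nat" and m where
      *: "inj_on f (B ` pverts G)" "f ` (B ` pverts G) = {i. i < m}"
      using finite_imp_inj_to_nat_seg by metis
    then have "card (B ` pverts G) = m"
      using card_image[of f "B ` pverts G"] by simp
    then show ?thesis
      using * that by blast
  qed
  define c where "c v = f (B v)" for v
  define h where "h v = rank v mod s" for v
  have verts: "u \<in> pverts G" "v \<in> pverts G" if "(u, v) \<in> parcs G" for u v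
    using that in_arcsD1 in_arcsD2 by auto
  have cD: "T u = T v \<and> rank u div s = rank v div s" if "c u = c v" "u \<in> pverts G" "v \<in> pverts G" for u v
    using that f(1) by (auto simp: c_def B_def inj_on_def)
  \<comment> \<open>Within one block the quotient by \<open>s\<close> is constant, so the remainder
    orders vertices as \<open>rank\<close> does.\<close>
  have rank_less: "rank u < rank v" if "c u = c v" "u \<in> pverts G" "v \<in> pverts G" "h u < h v" for u v
    using cD[OF that(1-3)] that(4) unfolding h_def
    by (metis add_less_cancel_left mult_div_mod_eq)
  have lt: "(u, v) \<in> lt (T u)" if "c u = c v" "u \<in> pverts G" "v \<in> pverts G" "h u < h v" for u v
    using rank_less[OF that] cD[OF that(1-3)] T that fin_V lin
    unfolding rank_def by (metis rank_in_less_iff)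
  show ?thesis
  proof (rule that)
    show "c v < 2 * t" if "v \<in> pverts G" for v
    proof -
      have "c v \<in> {i. i < card (B ` pverts G)}"
        using f(2) that by (auto simp: c_def)
      then show ?thesis
        using \<open>card (B ` pverts G) \<le> 2 * t\<close> by simp
    qed
    show "h v < ?n div t + 1" for v
      by (simp add: h_def s_def)
    show "u = v" if uv: "u \<in> pverts G" "v \<in> pverts G" "c u = c v" "h u = h v" for u v
    proof -
      have "T u = T v" "rank u = rank v"
        using cD[of u v] uv unfolding h_def by (metis mult_div_mod_eq)+
      then show ?thesis
        using rank_in_eq_imp_eq[of "T u" u v "lt (T u)"] T[of u] T[of v] uv fin_V lin
        by (simp add: rank_def)
    qed
    show "c u \<noteq> c v" if "(u, v) \<in> parcs G" for u v
      using cD[of u v] col[of "T u" u v] that T verts by metis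
    show "h v \<le> h y" if a: "(u, v) \<in> parcs G" "(x, y) \<in> parcs G" and e: "c u = c x" "c v = c y"
      and less: "h u < h x" for u v x y
    proof (rule ccontr)
      assume "\<not> h v \<le> h y"
      then have less': "h y < h v"
        by simp
      \<comment> \<open>Equal colours give equal tracks, so a crossing between blocks is one between
        the original tracks.\<close>
      have T_eq: "T u = T x" "T v = T y"
        using cD[of u x] cD[of v y] e verts[OF a(1)] verts[OF a(2)] by auto
      have "(u, x) \<in> lt (T u)" "(y, v) \<in> lt (T v)"
        using lt[of u x] lt[of y v] T_eq e less less' verts[OF a(1)] verts[OF a(2)] by auto
      moreover have "T u \<noteq> T v"
        using col[of "T u" u v] a T verts[OF a(1)] by auto
      moreover have "T u \<in> P" "T v \<in> P" "u \<in> T u" "x \<in> T u" "v \<in> T v" "y \<in> T v"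
        using T[of u] T[of v] T[of x] T[of y] T_eq verts[OF a(1)] verts[OF a(2)] by auto
      ultimately have "X_crossing G P lt"
        unfolding X_crossing_def using a by blast
      then show False
        using noX by contradiction
    qed
  qed
qed

section \<open>Track layouts from drawings\<close>

text \<open>The tracks are the nonempty fibres of \<open>f\<close>, all ordered by the same
  real-valued function. This form serves both the trivial layout and the one read off a
  drawing.\<close>

lemma ex_track_layout_fibres:
  fixes G :: "'a pair_pre_digraph" and f :: "'a \<Rightarrow> 'b" and ord :: "'a \<Rightarrow> real"
  assumes "pair_graph G"
    and proper: "\<And>u v. (u, v) \<in> parcs G \<Longrightarrow> f u \<noteq> f v"
    and inj: "\<And>u v. u \<in> pverts G \<Longrightarrow> v \<in> pverts G \<Longrightarrow> f u = f v \<Longrightarrow> ord u = ord v \<Longrightarrow> u = v"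
    and mono: "\<And>u v x y. (u, v) \<in> parcs G \<Longrightarrow> (x, y) \<in> parcs G \<Longrightarrow> f u = f x \<Longrightarrow> f v = f y \<Longrightarrow>
        ord u < ord x \<Longrightarrow> ord v \<le> ord y"
  shows "\<exists>P lt. track_layout G (card (f ` pverts G)) P lt"
proof -
  interpret pair_graph G by fact
  define V where "V c = {v \<in> pverts G. f v = c}" for c
  let ?P = "V ` f ` pverts G" and ?lt = "\<lambda>_. {(u, v). ord u < ord v}"
  have "partition_on (pverts G) ?P"
    by (rule partition_onI) (auto simp: V_def disjnt_def)
  then have "colouring G ?P"
    unfolding colouring_def by (auto simp: V_def dest!: proper)
  moreover have "\<forall>W\<in>?P. strict_linear_order_on W (?lt W)"
  proof
    fix W assume "W \<in> ?P"
    have "ord u \<noteq> ord v" if "u \<in> W" "v \<in> W" "u \<noteq> v" for u v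
      using inj[of u v] that \<open>W \<in> ?P\<close> by (auto simp: V_def)
    then have "ord u < ord v \<or> ord v < ord u" if "u \<in> W" "v \<in> W" "u \<noteq> v" for u v
      using that neq_iff by blast
    then show "strict_linear_order_on W (?lt W)"
      by (auto simp: strict_linear_order_on_def trans_def irrefl_def total_on_def)
  qed
  moreover have "\<not> X_crossing G ?P ?lt"
  proof
    assume "X_crossing G ?P ?lt"
    then obtain V' W' v x w y where "V' \<in> ?P" "W' \<in> ?P" "v \<in> V'" "x \<in> V'" "w \<in> W'" "y \<in> W'"
      and *: "(v, w) \<in> parcs G" "(x, y) \<in> parcs G" "(v, x) \<in> ?lt V'" "(y, w) \<in> ?lt W'"
      unfolding X_crossing_def by blast
    then have "f v = f x" "f w = f y"
      by (auto simp: V_def)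
    then show False
      using mono[of v w x y] * by simp
  qed
  moreover have "card ?P = card (f ` pverts G)"
    by (rule card_image) (auto simp: inj_on_def V_def)
  ultimately have "track_layout G (card (f ` pverts G)) ?P ?lt"
    unfolding track_layout_def track_assignment_def by blast
  then show ?thesis
    by (intro exI)
qed

lemma track_number_le_card_fibres:
  fixes G :: "'a pair_pre_digraph" and f :: "'a \<Rightarrow> 'b" and ord :: "'a \<Rightarrow> real"
  assumes "pair_graph G"
    and "\<And>u v. (u, v) \<in> parcs G \<Longrightarrow> f u \<noteq> f v"
    and "\<And>u v. u \<in> pverts G \<Longrightarrow> v \<in> pverts G \<Longrightarrow> f u = f v \<Longrightarrow> ord u = ord v \<Longrightarrow> u = v"
    and "\<And>u v x y. (u, v) \<in> parcs G \<Longrightarrow> (x, y) \<in> parcs G \<Longrightarrow> f u = f x \<Longrightarrow> f v = f y \<Longrightarrow>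
        ord u < ord x \<Longrightarrow> ord v \<le> ord y"
  shows "track_number G \<le> card (f ` pverts G)"
  unfolding track_number_def by (rule Least_le) (rule ex_track_layout_fibres[OF assms])

text \<open>With every vertex on a track of its own no X-crossing is possible, so the
  \<open>LEAST\<close> in \<open>track_number\<close> is attained.\<close>

lemma
  assumes "pair_graph G"
  shows track_number_le_card: "track_number G \<le> card (pverts G)"
    and ex_track_layout_track_number: "\<exists>P lt. track_layout G (track_number G) P lt"
proof -
  interpret pair_graph G by fact
  have "\<exists>P lt. track_layout G (card (id ` pverts G)) P lt"
    by (rule ex_track_layout_fibres[of G id "\<lambda>_. 0"]) (use assms no_loops' in auto)
  then have *: "\<exists>P lt. track_layout G (card (pverts G)) P lt"
    by simp
  then show "track_number G \<le> card (pverts G)"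
    unfolding track_number_def by (rule Least_le)
  show "\<exists>P lt. track_layout G (track_number G) P lt"
    unfolding track_number_def by (rule LeastI) (rule *)
qed

text \<open>Rounding both ends inward gives an integer interval. For \<open>n = 0\<close> the upper
  end is below \<open>a\<close> and the set is empty.\<close>

lemma Ints_atLeastAtMost:
  fixes a :: real
  shows "finite {x \<in> \<int>. a \<le> x \<and> x \<le> a + (real n - 1)}"
    and "card {x \<in> \<int>. a \<le> x \<and> x \<le> a + (real n - 1)} \<le> n"
proof -
  have eq: "{x \<in> \<int>. a \<le> x \<and> x \<le> a + (real n - 1)} = of_int ` {\<lceil>a\<rceil>..\<lfloor>a + (real n - 1)\<rfloor>}"
    by (auto simp: Ints_def ceiling_le_iff le_floor_iff)
  then show "finite {x \<in> \<int>. a \<le> x \<and> x \<le> a + (real n - 1)}"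
    by simp
  have "card {x \<in> \<int>. a \<le> x \<and> x \<le> a + (real n - 1)} \<le> card {\<lceil>a\<rceil>..\<lfloor>a + (real n - 1)\<rfloor>}"
    unfolding eq by (rule card_image_le) simp
  also have "\<dots> \<le> n"
    by simp linarith
  finally show "card {x \<in> \<int>. a \<le> x \<and> x \<le> a + (real n - 1)} \<le> n" .
qed

lemma in_closed_segment_3I:
  fixes a b q :: "real ^ 3"
  assumes "0 \<le> s" and "s \<le> 1" and "q $ 1 = a $ 1 + s * (b $ 1 - a $ 1)"
    and "q $ 2 = a $ 2 + s * (b $ 2 - a $ 2)" and "q $ 3 = a $ 3 + s * (b $ 3 - a $ 3)"
  shows "q \<in> closed_segment a b"
  unfolding in_segment using assms
  by (intro exI[of _ s]) (simp add: vec_eq_iff forall_3 algebra_simps)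

text \<open>Every vertical line of the drawing is split into two tracks, according to the parity of the
  height rank of the vertices on it: an edge inside the line joins vertices of consecutive ranks.\<close>
proposition track_number_le_of_drawing:
  fixes G :: "'a pair_pre_digraph"
  assumes "pair_graph G" and "has_drawing G A B C"
  shows "track_number G \<le> 2 * (A * B)"
proof -
  interpret pair_graph G by fact
  obtain p a where "drawing_3d G p"
    and box: "drawing_points G p \<subseteq> cbox a (a + vector [real A - 1, real B - 1, real C - 1])"
    using assms(2) unfolding has_drawing_def by blast
  note drawing = \<open>drawing_3d G p\<close>[unfolded drawing_3d_def]
  have inj_p: "inj_on p (pverts G)" and ints: "\<And>v i. v \<in> pverts G \<Longrightarrow> p v $ i \<in> \<int>"
    using drawing[THEN conjunct1] drawing[THEN conjunct2, THEN conjunct1] by auto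
  have vertex: "w \<in> {u, v}"
    if "(u, v) \<in> parcs G" "w \<in> pverts G" "p w \<in> closed_segment (p u) (p v)" for u v w
    using drawing[THEN conjunct2, THEN conjunct2, THEN conjunct1, rule_format, OF that] .
  have edges: "closed_segment (p u) (p v) \<inter> closed_segment (p x) (p y) \<subseteq> p ` ({u, v} \<inter> {x, y})"
    if "(u, v) \<in> parcs G" "(x, y) \<in> parcs G" "{u, v} \<noteq> {x, y}" for u v x y
    using drawing[THEN conjunct2, THEN conjunct2, THEN conjunct2, rule_format, OF that] .
  have verts: "u \<in> pverts G" "v \<in> pverts G" if "(u, v) \<in> parcs G" for u v
    using that in_arcsD1 in_arcsD2 by auto
  define line where "line v = (p v $ 1, p v $ 2)" for v
  define below where "below v = {w \<in> pverts G. line w = line v \<and> p w $ 3 < p v $ 3}" for v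
  define rank where "rank v = card (below v)" for v
  define f where "f v = (line v, rank v mod 2)" for v
  have fin: "finite (below v)" for v
    unfolding below_def using pair_finite_verts by simp
  have eq: "u = v" if "u \<in> pverts G" "v \<in> pverts G" "line u = line v" "p u $ 3 = p v $ 3" for u v
  proof -
    have "p u = p v"
      using that by (simp add: vec_eq_iff forall_3 line_def)
    then show ?thesis
      using inj_p that by (auto dest: inj_onD)
  qed
  have rank_less: "rank u < rank v" if "u \<in> pverts G" "line u = line v" "p u $ 3 < p v $ 3" for u v
    unfolding rank_def by (rule psubset_card_mono) (use that fin in \<open>auto simp: below_def\<close>)
  have consecutive: "rank v = rank u + 1"
    if uv: "(u, v) \<in> parcs G" and l: "line u = line v" and less: "p u $ 3 < p v $ 3" for u v
  proof -
    have "w \<in> insert u (below u)" if w: "w \<in> below v" for w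
    proof (rule ccontr)
      assume "w \<notin> insert u (below u)"
      then have w': "w \<in> pverts G" "line w = line u" "w \<noteq> u" "p u $ 3 \<le> p w $ 3" "p w $ 3 < p v $ 3"
        using w l by (auto simp: below_def)
      \<comment> \<open>A vertex of the line at these heights would lie on the edge, at the
        parameter \<open>s\<close> given by its height.\<close>
      define s where "s = (p w $ 3 - p u $ 3) / (p v $ 3 - p u $ 3)"
      have "p w \<in> closed_segment (p u) (p v)"
        by (rule in_closed_segment_3I[of s])
          (use w' less l in \<open>auto simp: s_def line_def field_simps\<close>)
      then have "w = v"
        using vertex[OF uv] w' by auto
      then show False
        using w' by simp
    qed
    moreover have "insert u (below u) \<subseteq> below v"
      using l less verts[OF uv] by (auto simp: below_def)
    ultimately have "below v = insert u (below u)"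
      by blast
    then show ?thesis
      using fin[of u] unfolding rank_def by (simp add: below_def)
  qed
  have adjacent: "rank v = rank u + 1 \<or> rank u = rank v + 1"
    if uv: "(u, v) \<in> parcs G" and l: "line u = line v" for u v
  proof -
    have "p u $ 3 \<noteq> p v $ 3"
      using eq l verts[OF uv] no_loops'[OF uv] by blast
    then show ?thesis
      using consecutive[OF uv l] consecutive[of v u] l arcs_symmetric[OF uv] by fastforce
  qed
  have "track_number G \<le> card (f ` pverts G)"
  proof (rule track_number_le_card_fibres)
    show "pair_graph G" by fact
    show "f u \<noteq> f v" if "(u, v) \<in> parcs G" for u v
      using adjacent[OF that] unfolding f_def by (auto simp: mod2_eq_if split: if_splits)
    show "u = v" if "u \<in> pverts G" "v \<in> pverts G" "f u = f v" "p u $ 3 = p v $ 3" for u v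
      using that eq by (simp add: f_def)
    show "p v $ 3 \<le> p y $ 3"
      if uv: "(u, v) \<in> parcs G" and xy: "(x, y) \<in> parcs G" and f: "f u = f x" "f v = f y"
        and less: "p u $ 3 < p x $ 3" for u v x y
    proof (rule ccontr)
      assume "\<not> ?thesis"
      then have less': "p y $ 3 < p v $ 3"
        by simp
      have l: "line u = line x" "line v = line y" and
        m: "rank u mod 2 = rank x mod 2" "rank v mod 2 = rank y mod 2"
        using f by (auto simp: f_def)
      show False
      proof (cases "line u = line v")
        case True
        \<comment> \<open>Equal parity gives \<open>rank x \<ge> rank u + 2\<close>. Ranks along an
          edge differ by 1, so \<open>rank v \<le> rank u + 1 \<le> rank x - 1 \<le> rank y\<close>,
          a contradiction.\<close>
        have "rank u < rank x" "rank y < rank v"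
          using rank_less[of u x] rank_less[of y v] l less less' verts[OF uv] verts[OF xy] by auto
        moreover have "rank x \<noteq> rank u + 1"
          using m by presburger
        ultimately show False
          using adjacent[OF uv True] adjacent[OF xy] True l by auto
      next
        case False
        then have ne: "{u, v} \<inter> {x, y} = {}"
          using l less less' by auto
        \<comment> \<open>Both edges lie over the same horizontal segment. Their vertical gap
          changes sign between the two ends; \<open>d\<close> is its total change and
          \<open>s\<close> the parameter where it vanishes.\<close>
        define d where "d = (p x $ 3 - p u $ 3) + (p v $ 3 - p y $ 3)"
        define s where "s = (p x $ 3 - p u $ 3) / d"
        have d: "d > 0"
          using less less' by (simp add: d_def)
        have s: "0 \<le> s" "s \<le> 1"
          using d less less' by (auto simp: s_def d_def)
        have sd: "s * d = p x $ 3 - p u $ 3"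
          using d by (simp add: s_def)
        define q where "q = p u + s *\<^sub>R (p v - p u)"
        have "q \<in> closed_segment (p u) (p v)"
          using s by (intro in_closed_segment_3I) (auto simp: q_def)
        moreover have "q \<in> closed_segment (p x) (p y)"
          using s l sd by (intro in_closed_segment_3I) (auto simp: q_def line_def d_def algebra_simps)
        ultimately show False
          using edges[OF uv xy] ne by auto
      qed
    qed
  qed
  also have "card (f ` pverts G) \<le> card (({x \<in> \<int>. a $ 1 \<le> x \<and> x \<le> a $ 1 + (real A - 1)}
      \<times> {x \<in> \<int>. a $ 2 \<le> x \<and> x \<le> a $ 2 + (real B - 1)}) \<times> {0, 1 :: nat})"
    (is "_ \<le> card ((?X \<times> ?Y) \<times> _)")
  proof (rule card_mono)
    show "finite ((?X \<times> ?Y) \<times> {0, 1 :: nat})"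
      by (simp add: Ints_atLeastAtMost)
    have "f v \<in> (?X \<times> ?Y) \<times> {0, 1}" if "v \<in> pverts G" for v
    proof -
      have "p v \<in> cbox a (a + vector [real A - 1, real B - 1, real C - 1])"
        using box that by (auto simp: drawing_points_def)
      then show ?thesis
        using ints[OF that] by (auto simp: f_def line_def mem_box_cart forall_3)
    qed
    then show "f ` pverts G \<subseteq> (?X \<times> ?Y) \<times> {0, 1}"
      by blast
  qed
  also have "\<dots> = card ?X * card ?Y * 2"
    by (simp add: card_cartesian_product)
  also have "\<dots> \<le> A * B * 2"
    by (intro mult_le_mono Ints_atLeastAtMost le_refl)
  finally show ?thesis
    by (simp add: mult.commute)
qed

section \<open>Drawings and track numbers of families\<close>

lemma has_drawing_mono:
  assumes "has_drawing G A B C" and "A \<le> A'" and "B \<le> B'" and "C \<le> C'"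
  shows "has_drawing G A' B' C'"
proof -
  obtain p a where p: "drawing_3d G p"
    "drawing_points G p \<subseteq> cbox a (a + vector [real A - 1, real B - 1, real C - 1])"
    using assms(1) unfolding has_drawing_def by blast
  have "cbox a (a + vector [real A - 1, real B - 1, real C - 1])
      \<subseteq> cbox a (a + vector [real A' - 1, real B' - 1, real C' - 1])"
    using assms(2-4) by (force simp: mem_box_cart forall_3)
  then show ?thesis
    unfolding has_drawing_def using p by blast
qed

text \<open>Treats the graph of track number 0, for which all required side bounds are 0 and the box
  is empty.\<close>

lemma has_drawing_no_verts:
  assumes "pair_graph G" and "pverts G = {}"
  shows "has_drawing G A B C"
proof -
  interpret pair_graph G by fact
  have "parcs G = {}"
    using in_arcsD1 assms(2) by auto
  then show ?thesis
    unfolding has_drawing_def drawing_3d_def drawing_points_def using assms(2) by simp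
qed

text \<open>The residue in the third coordinate is below \<open>p\<close>, so layer \<open>h\<close>
  stays below height \<open>p * (h + 1)\<close>. The corner \<open>0\<close> is left as a summand to
  match \<open>has_drawing\<close>.\<close>

lemma moment_point_in_cbox:
  assumes "c < p" and "h < s"
  shows "moment_point p c h \<in> cbox 0 (0 + vector [real p - 1, real p - 1, real (p * s) - 1])"
proof -
  have p: "p > 0"
    using assms by simp
  have "p * h + c ^ 3 mod p < p * h + p"
    using p by simp
  also have "\<dots> = p * Suc h"
    by simp
  also have "\<dots> \<le> p * s"
    using assms by (intro mult_le_mono2) simp
  finally have "real (p * h + c ^ 3 mod p) + 1 \<le> real (p * s)"
    by linarith
  moreover have "real (c\<^sup>2 mod p) + 1 \<le> real p"
    using mod_less_divisor[OF p, of "c\<^sup>2"] by linarith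
  ultimately show ?thesis
    using assms(1) by (simp add: mem_box_cart forall_3 moment_point_def)
qed

proposition ex_drawing_of_track_number:
  "\<exists>c::real>0. \<forall>G :: 'a pair_pre_digraph. pair_graph G \<longrightarrow>
     (\<exists>A B C. has_drawing G A B C \<and> real A \<le> c * real (track_number G) \<and>
        real B \<le> c * real (track_number G) \<and> real C \<le> c * real (card (pverts G)))"
proof -
  obtain K :: nat where K: "\<And>n. n \<ge> 1 \<Longrightarrow> \<exists>p. prime p \<and> n \<le> p \<and> p \<le> K * n"
    using ex_prime_linear by blast
  \<comment> \<open>The estimates below give \<open>p \<le> 2 * K * t\<close> and
    \<open>p * s \<le> 4 * K * n\<close>; the summand 1 makes the constant positive whatever
    \<open>K\<close> is.\<close>
  have "\<exists>A B C. has_drawing G A B C \<and> A \<le> (4 * K + 1) * track_number G \<and>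
      B \<le> (4 * K + 1) * track_number G \<and> C \<le> (4 * K + 1) * card (pverts G)"
    if G: "pair_graph G" for G :: "'a pair_pre_digraph"
  proof (cases "pverts G = {}")
    case True
    then show ?thesis
      using has_drawing_no_verts[OF G] by (metis le0)
  next
    case False
    interpret pair_graph G by fact
    let ?n = "card (pverts G)" and ?t = "track_number G"
    define s where "s = ?n div ?t + 1"
    obtain P lt where layout: "track_layout G ?t P lt"
      using ex_track_layout_track_number[OF G] by blast
    obtain col h :: "'a \<Rightarrow> nat" where
      col: "\<And>v. v \<in> pverts G \<Longrightarrow> col v < 2 * ?t"
      and h: "\<And>v. h v < s"
      and inj: "\<And>u v. u \<in> pverts G \<Longrightarrow> v \<in> pverts G \<Longrightarrow> col u = col v \<Longrightarrow> h u = h v \<Longrightarrow> u = v"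
      and proper: "\<And>u v. (u, v) \<in> parcs G \<Longrightarrow> col u \<noteq> col v"
      and mono: "\<And>u v x y. (u, v) \<in> parcs G \<Longrightarrow> (x, y) \<in> parcs G \<Longrightarrow> col u = col x \<Longrightarrow>
        col v = col y \<Longrightarrow> h u < h x \<Longrightarrow> h v \<le> h y"
      using that by (rule track_layout_balance[OF G layout False, folded s_def])
    \<comment> \<open>Some vertex has a colour below \<open>2 * t\<close>; the prime bound requires
      a positive argument.\<close>
    have t: "2 * ?t \<ge> 1"
      using False col by fastforce
    then obtain p where p: "prime p" "2 * ?t \<le> p" "p \<le> K * (2 * ?t)"
      using K by blast
    have col_p: "col v < p" if "v \<in> pverts G" for v
      using col[OF that] p(2) by linarith
    let ?P = "\<lambda>v. moment_point p (col v) (h v)"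
      and ?box = "cbox 0 (0 + vector [real p - 1, real p - 1, real (p * s) - 1]) :: (real ^ 3) set"
    have "drawing_3d G ?P"
      by (rule drawing_3d_moment_point[OF G p(1) col_p inj proper mono])
    moreover have "drawing_points G ?P \<subseteq> ?box"
    proof -
      have vert: "?P v \<in> ?box" if "v \<in> pverts G" for v
        using col_p[OF that] h by (rule moment_point_in_cbox)
      then have "closed_segment (?P u) (?P v) \<subseteq> ?box" if "(u, v) \<in> parcs G" for u v
        using in_arcsD1[OF that] in_arcsD2[OF that] convex_box(1)
        by (intro closed_segment_subset) auto
      then show ?thesis
        unfolding drawing_points_def using vert by blast
    qed
    ultimately have "has_drawing G p p (p * s)"
      unfolding has_drawing_def by blast
    moreover have "p \<le> (4 * K + 1) * ?t"
      using p(3) by (simp add: algebra_simps)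
    moreover have "p * s \<le> (4 * K + 1) * ?n"
    proof -
      have "p * s \<le> K * (2 * ?t) * s"
        using p(3) by (rule mult_le_mono1)
      also have "\<dots> = 2 * K * (?t * (?n div ?t) + ?t)"
        by (simp add: s_def algebra_simps)
      \<comment> \<open>Rounding \<open>n / t\<close> up costs one extra \<open>t\<close>, which is
        absorbed because \<open>t \<le> n\<close>.\<close>
      also have "\<dots> \<le> 2 * K * (?n + ?n)"
        using track_number_le_card[OF G] by (intro mult_le_mono2 add_mono) simp_all
      finally show ?thesis
        by (simp add: algebra_simps)
    qed
    ultimately show ?thesis
      by blast
  qed
  note * = this
  show ?thesis
  proof (intro exI[of _ "real (4 * K + 1)"] conjI allI impI)
    fix G :: "'a pair_pre_digraph"
    assume "pair_graph G"
    then obtain A B C where "has_drawing G A B C" "A \<le> (4 * K + 1) * track_number G"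
      "B \<le> (4 * K + 1) * track_number G" "C \<le> (4 * K + 1) * card (pverts G)"
      using * by blast
    then show "\<exists>A B C. has_drawing G A B C \<and> real A \<le> real (4 * K + 1) * real (track_number G) \<and>
        real B \<le> real (4 * K + 1) * real (track_number G) \<and>
        real C \<le> real (4 * K + 1) * real (card (pverts G))"
      unfolding of_nat_mult[symmetric] of_nat_le_iff by blast
  qed simp
qed

text \<open>The bound by the number of vertices makes the set under \<open>Max\<close>
  finite.\<close>

lemma track_number_le_family_track_number:
  assumes "\<forall>G\<in>\<G>. pair_graph G" and "G \<in> \<G>"
  shows "track_number G \<le> family_track_number \<G> (card (pverts G))"
proof -
  have "{track_number H | H. H \<in> \<G> \<and> card (pverts H) = card (pverts G)} \<subseteq> {..card (pverts G)}"
  proof safe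
    fix H assume H: "H \<in> \<G>" "card (pverts H) = card (pverts G)"
    then have "track_number H \<le> card (pverts H)"
      using assms(1) track_number_le_card by blast
    then show "track_number H \<le> card (pverts G)"
      using H by simp
  qed
  then have "finite {track_number H | H. H \<in> \<G> \<and> card (pverts H) = card (pverts G)}"
    by (rule finite_subset) simp
  then show ?thesis
    unfolding family_track_number_def using assms(2) by (intro Max_ge) auto
qed

lemma family_track_number_le:
  assumes "\<And>G. G \<in> \<G> \<Longrightarrow> card (pverts G) = n \<Longrightarrow> track_number G \<le> m"
  shows "family_track_number \<G> n \<le> m"
proof -
  have *: "{track_number G | G. G \<in> \<G> \<and> card (pverts G) = n} \<subseteq> {..m}"
    using assms by auto
  then have "finite {track_number G | G. G \<in> \<G> \<and> card (pverts G) = n}"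
    by (rule finite_subset) simp
  then show ?thesis
    unfolding family_track_number_def using * by (subst Max_le_iff) auto
qed

theorem theorem2p9:
  shows "(\<exists>c::real. \<forall>G :: 'a pair_pre_digraph. pair_graph G \<longrightarrow>
            (\<exists>A B C. has_drawing G A B C \<and>
               real A \<le> c * real (track_number G) \<and>
               real B \<le> c * real (track_number G) \<and>
               real C \<le> c * real (card (pverts G))))
       \<and> (\<forall>(\<G> :: 'a pair_pre_digraph set) (F :: (nat \<Rightarrow> real) set).
            (\<forall>G \<in> \<G>. pair_graph G) \<longrightarrow> growth_family F \<longrightarrow> closed_under_multiplication F \<longrightarrow>
            ((\<exists>A B C :: nat \<Rightarrow> nat.
                (\<lambda>n. real (A n)) \<in> F \<and> (\<lambda>n. real (B n)) \<in> F \<and>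
                (\<lambda>n. real (C n)) \<in> O(\<lambda>n. real n) \<and>
                (\<forall>n. \<forall>G \<in> \<G>. card (pverts G) = n \<longrightarrow> has_drawing G (A n) (B n) (C n)))
             \<longleftrightarrow> (\<lambda>n. real (family_track_number \<G> n)) \<in> F))"
proof (intro conjI allI impI)
  show "\<exists>c::real. \<forall>G :: 'a pair_pre_digraph. pair_graph G \<longrightarrow>
      (\<exists>A B C. has_drawing G A B C \<and> real A \<le> c * real (track_number G) \<and>
         real B \<le> c * real (track_number G) \<and> real C \<le> c * real (card (pverts G)))"
    using ex_drawing_of_track_number by blast
next
  fix \<G> :: "'a pair_pre_digraph set" and F :: "(nat \<Rightarrow> real) set"
  assume \<G>: "\<forall>G\<in>\<G>. pair_graph G" and F: "growth_family F" and mult: "closed_under_multiplication F"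
  have F_le: "g \<in> F" if "f \<in> F" "\<And>n. 0 \<le> g n" "\<And>n. g n \<le> f n" for f g
    using F that unfolding growth_family_def by blast
  have F_scale: "(\<lambda>n. k * f n) \<in> F" if "f \<in> F" "k > 0" for f k
    using F that unfolding growth_family_def by blast
  show "(\<exists>A B C :: nat \<Rightarrow> nat. (\<lambda>n. real (A n)) \<in> F \<and> (\<lambda>n. real (B n)) \<in> F \<and>
           (\<lambda>n. real (C n)) \<in> O(\<lambda>n. real n) \<and>
           (\<forall>n. \<forall>G \<in> \<G>. card (pverts G) = n \<longrightarrow> has_drawing G (A n) (B n) (C n)))
        \<longleftrightarrow> (\<lambda>n. real (family_track_number \<G> n)) \<in> F" (is "?L \<longleftrightarrow> ?R")
  proof
    assume ?L
    then obtain A B C :: "nat \<Rightarrow> nat" where A: "(\<lambda>n. real (A n)) \<in> F" and B: "(\<lambda>n. real (B n)) \<in> F"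
      and draw: "\<And>G. G \<in> \<G> \<Longrightarrow> has_drawing G (A (card (pverts G))) (B (card (pverts G))) (C (card (pverts G)))"
      by blast
    \<comment> \<open>Closure under multiplication covers the number of vertical lines, scaling the
      two tracks on each of them.\<close>
    have "(\<lambda>n. 2 * (real (A n) * real (B n))) \<in> F"
      using mult A B by (intro F_scale) (auto simp: closed_under_multiplication_def)
    then show ?R
    proof (rule F_le)
      fix n
      have "family_track_number \<G> n \<le> 2 * (A n * B n)"
        using track_number_le_of_drawing \<G> draw by (intro family_track_number_le) blast
      then have "real (family_track_number \<G> n) \<le> real (2 * (A n * B n))"
        by (rule of_nat_mono)
      then show "real (family_track_number \<G> n) \<le> 2 * (real (A n) * real (B n))"
        by simp
    qed simp
  next
    assume R: ?R
    obtain c :: real where c: "c > 0" and draw: "\<And>G :: 'a pair_pre_digraph. pair_graph G \<Longrightarrow>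
       \<exists>A B C. has_drawing G A B C \<and> real A \<le> c * real (track_number G) \<and>
        real B \<le> c * real (track_number G) \<and> real C \<le> c * real (card (pverts G))"
      using ex_drawing_of_track_number by blast
    \<comment> \<open>These bounds depend on \<open>n\<close> only and so serve all
      \<open>n\<close>-vertex graphs of the family. Rounding down loses nothing, as side lengths are
      natural numbers; \<open>A\<close> serves for both horizontal sides.\<close>
    define A where "A n = nat \<lfloor>c * real (family_track_number \<G> n)\<rfloor>" for n
    define C where "C n = nat \<lfloor>c * real n\<rfloor>" for n
    have "(\<lambda>n. real (A n)) \<in> F"
      by (rule F_le[OF F_scale[OF R c]]) (use c in \<open>simp_all add: A_def\<close>)
    moreover have "(\<lambda>n. real (C n)) \<in> O(\<lambda>n. real n)"
    proof (rule bigoI[of _ c], rule always_eventually, rule allI)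
      show "norm (real (C n)) \<le> c * norm (real n)" for n
        using c by (simp add: C_def)
    qed
    moreover have "has_drawing G (A n) (A n) (C n)" if "G \<in> \<G>" "card (pverts G) = n" for G n
    proof -
      have "pair_graph G"
        using \<G> that(1) by blast
      then obtain A' B' C' where d: "has_drawing G A' B' C'" "real A' \<le> c * real (track_number G)"
        "real B' \<le> c * real (track_number G)" "real C' \<le> c * real n"
        using draw \<open>card (pverts G) = n\<close> by blast
      have "real (track_number G) \<le> real (family_track_number \<G> n)"
        using track_number_le_family_track_number[OF \<G> that(1)] that(2) by simp
      then have "c * real (track_number G) \<le> c * real (family_track_number \<G> n)"
        using c by simp
      then have "A' \<le> A n" "B' \<le> A n" "C' \<le> C n"
        using d(2-4) unfolding A_def C_def by (simp_all add: le_nat_floor)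
      then show ?thesis
        using has_drawing_mono d(1) by blast
    qed
    ultimately show ?L
      by blast
  qed
qed

end
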